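(* Let $E$ be a finite nonempty set and, for each $i\in E$, let $(R_i,P)\sim\mathcal{N}_{m+1}(\mu_i,\Gamma_i)$ be jointly Gaussian, where $R_i$ is real valued and $P$ takes values in $\mathbb{R}^m$, with $\Gamma=\mathbb{C}\mathrm{ov}(P)$ invertible. For each $i\in E$ let $\rho_i(L)=\frac{1}{\varrho_i}\ln\big(\mathbb{E}[\exp(\varrho_i L)]\big)$ for some $\varrho_i>0$. Set $\mu=\mathbb{E}[P]$, $\mathrm{cov}_i=(\mathbb{C}\mathrm{ov}(R_i,P_1),\dots,\mathbb{C}\mathrm{ov}(R_i,P_m))\in\mathbb{R}^m$, $\mathrm{cov}=\sum_{i\in E}\mathrm{cov}_i$ and $\varrho=\big(\sum_{i\in E}\frac{1}{\varrho_i}\big)^{-1}$. Then $$\mathbf{q}_i=\Gamma^{-1}\Big(\frac{\varrho}{\varrho_i}\,\mathrm{cov}-\mathrm{cov}_i\Big),\ i\in E,\qquad \mathbf{p}=\mu-\varrho\,\mathrm{cov},$$ is a Radner equilibrium on $E$, and it is the unique Radner equilibrium on $E$.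
   Context: The random variables are defined on a probability space $(\Omega,\mathcal{A},\mathbb{P})$; $m\ge1$. The entropic risk measures $\rho_i$ are defined on the space $\mathcal{X}$ of random variables $L$ such that $\mathbb{E}[\exp(c|L|)]<\infty$ for all $c>0$. $\mathcal{N}_n(\mu,\Gamma)$ is the $n$-variate Gaussian distribution with mean $\mu$ and covariance matrix $\Gamma$. Radner equilibrium on $E$: a family $(\mathbf{q}_i)_{i\in E}$ in $\mathbb{R}^m$ and a vector $\mathbf{p}\in\mathbb{R}^m$ such that (optimality) for every $i\in E$ and every $q_i\in\mathbb{R}^m$, $\rho_i(-R_i+\mathbf{q}_i^\top(\mathbf{p}-P))\le\rho_i(-R_i+q_i^\top(\mathbf{p}-P))$, and (zero clearing) $\sum_{i\in E}\mathbf{q}_i=0$. *)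

theory Defs
  imports "HOL-Probability.Probability"
begin

definition covariance :: "'w measure \<Rightarrow> ('w \<Rightarrow> real) \<Rightarrow> ('w \<Rightarrow> real) \<Rightarrow> real" where
  "covariance M X Y =
     (LINT \<omega>|M. (X \<omega> - (LINT \<omega>'|M. X \<omega>')) * (Y \<omega> - (LINT \<omega>'|M. Y \<omega>')))"

definition covariance_matrix :: "'w measure \<Rightarrow> ('w \<Rightarrow> real ^ 'n) \<Rightarrow> real ^ 'n ^ 'n" where
  "covariance_matrix M X = (\<chi> j k. covariance M (\<lambda>\<omega>. X \<omega> $ j) (\<lambda>\<omega>. X \<omega> $ k))"

text \<open>The univariate normal law is parametrised by its variance, and the degenerate case of
  variance zero, a point mass, is included.  Hence the Gaussian vectors below may have a singular
  covariance matrix.\<close>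

definition normal_law :: "real \<Rightarrow> real \<Rightarrow> real measure" where
  "normal_law m v =
     (if v = 0 then return borel m else density lborel (normal_density m (sqrt v)))"

definition gaussian_vector :: "'w measure \<Rightarrow> ('w \<Rightarrow> real ^ 'n) \<Rightarrow> bool" where
  "gaussian_vector M X \<longleftrightarrow>
     X \<in> borel_measurable M \<and>
     (\<forall>a. \<exists>m v. 0 \<le> v \<and> distr M borel (\<lambda>\<omega>. a \<bullet> X \<omega>) = normal_law m v)"

definition multivariate_normal ::
    "'w measure \<Rightarrow> ('w \<Rightarrow> real ^ 'n) \<Rightarrow> real ^ 'n \<Rightarrow> real ^ 'n ^ 'n \<Rightarrow> bool" where
  "multivariate_normal M X \<mu> \<Gamma> \<longleftrightarrow>
     gaussian_vector M X \<and> (LINT \<omega>|M. X \<omega>) = \<mu> \<and> covariance_matrix M X = \<Gamma>"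

text \<open>The vector \<open>(x, y)\<close> with \<open>m + 1\<close> entries, indexed by \<open>'m option\<close>: the index \<open>None\<close> is the
  real component \<open>x\<close>, the indices \<open>Some j\<close> are the components of \<open>y\<close>.\<close>

definition cons_vec :: "real \<Rightarrow> real ^ 'm \<Rightarrow> real ^ ('m option)" where
  "cons_vec x y = (\<chi> k. case k of None \<Rightarrow> x | Some j \<Rightarrow> y $ j)"

definition exp_moment_space :: "'w measure \<Rightarrow> ('w \<Rightarrow> real) set" where
  "exp_moment_space M =
     {L \<in> borel_measurable M. \<forall>c>0. integrable M (\<lambda>\<omega>. exp (c * \<bar>L \<omega>\<bar>))}"

text \<open>The risk measure is only specified on its domain \<open>exp_moment_space M\<close>; outside of it
  \<open>restrict\<close> makes the value \<open>undefined\<close>.\<close>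

definition entropic_risk :: "'w measure \<Rightarrow> real \<Rightarrow> ('w \<Rightarrow> real) \<Rightarrow> real" where
  "entropic_risk M r =
     restrict (\<lambda>L. 1 / r * ln (LINT \<omega>|M. exp (r * L \<omega>))) (exp_moment_space M)"

text \<open>Only the values \<open>q i\<close> with \<open>i \<in> E\<close> matter.\<close>

definition radner_equilibrium ::
    "'i set \<Rightarrow> ('i \<Rightarrow> ('w \<Rightarrow> real) \<Rightarrow> real) \<Rightarrow> ('i \<Rightarrow> 'w \<Rightarrow> real) \<Rightarrow> ('w \<Rightarrow> real ^ 'm) \<Rightarrow>
     ('i \<Rightarrow> real ^ 'm) \<Rightarrow> real ^ 'm \<Rightarrow> bool" where
  "radner_equilibrium E \<rho> R P q p \<longleftrightarrow>
     (\<forall>i\<in>E. \<forall>x. \<rho> i (\<lambda>\<omega>. - R i \<omega> + q i \<bullet> (p - P \<omega>)) \<le> \<rho> i (\<lambda>\<omega>. - R i \<omega> + x \<bullet> (p - P \<omega>))) \<and>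
     (\<Sum>i\<in>E. q i) = 0"

end

theory Submission
  imports Defs
begin

text \<open>For a normal variable \<open>X\<close> the entropic risk of \<open>a - X\<close> is \<open>a - E X + r / 2 * Var X\<close>, so each
  agent minimises a quadratic function of the portfolio whose Hessian is the positive
  semidefinite matrix \<open>r i\<close> times \<open>\<Gamma>\<close>.  Optimality at the price \<open>p\<close> is therefore equivalent to the
  first-order condition \<open>\<Gamma> q i = (\<mu> - p) / r i - c i\<close>.  Summing over the agents, clearing holds
  exactly when \<open>\<mu> - p = r\<^sub>E cov\<close>, because \<open>\<Gamma>\<close> is invertible.\<close>

section \<open>Moments of the univariate normal law, point masses included\<close>

text \<open>Completing the square: tilting by \<open>exp (t * x)\<close> shifts the mean by
  \<open>\<sigma>\<^sup>2 * t\<close> and pulls out a constant. As the shifted density has total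
  mass one, that constant is the moment generating function at \<open>t\<close>.\<close>

lemma normal_density_times_exp:
  assumes "0 < \<sigma>"
  shows "normal_density m \<sigma> x * exp (t * x) =
         exp (t * m + t\<^sup>2 * \<sigma>\<^sup>2 / 2) * normal_density (m + \<sigma>\<^sup>2 * t) \<sigma> x"
proof -
  have "- (x - m)\<^sup>2 / (2 * \<sigma>\<^sup>2) + t * x =
        t * m + t\<^sup>2 * \<sigma>\<^sup>2 / 2 + - (x - (m + \<sigma>\<^sup>2 * t))\<^sup>2 / (2 * \<sigma>\<^sup>2)"
    using assms by (simp add: field_simps power2_eq_square)
  then show ?thesis
    unfolding normal_density_def by (simp add: exp_add[symmetric] mult.assoc[symmetric] mult.commute)
qed

lemma normal_law_exp:
  assumes "0 \<le> v"
  shows integrable_normal_law_exp: "integrable (normal_law m v) (\<lambda>x. exp (t * x))"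
    and integral_normal_law_exp: "(LINT x|normal_law m v. exp (t * x)) = exp (t * m + t\<^sup>2 * v / 2)"
proof -
  have "integrable (normal_law m v) (\<lambda>x. exp (t * x)) \<and>
        (LINT x|normal_law m v. exp (t * x)) = exp (t * m + t\<^sup>2 * v / 2)"
  proof (cases "v = 0")
    case True
    then show ?thesis
      by (simp add: normal_law_def integral_return integrable_iff_bounded nn_integral_return)
  next
    case False
    with assms show ?thesis
      by (simp add: normal_law_def integrable_density integral_density normal_density_times_exp)
  qed
  then show "integrable (normal_law m v) (\<lambda>x. exp (t * x))"
    "(LINT x|normal_law m v. exp (t * x)) = exp (t * m + t\<^sup>2 * v / 2)" by auto
qed

lemma integral_normal_law_ident:
  assumes "0 \<le> v"
  shows "(LINT x|normal_law m v. x) = m"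
  using assms
  by (cases "v = 0")
    (simp_all add: normal_law_def integral_return integral_density integral_normal_moment_nz_1)

lemma normal_law_square:
  assumes "0 \<le> v"
  shows integrable_normal_law_square: "integrable (normal_law m v) (\<lambda>x. x\<^sup>2)"
    and integral_normal_law_square: "(LINT x|normal_law m v. (x - m)\<^sup>2) = v"
proof -
  show "integrable (normal_law m v) (\<lambda>x. x\<^sup>2)"
  proof (cases "v = 0")
    case True
    then show ?thesis
      by (simp add: normal_law_def integrable_iff_bounded nn_integral_return)
  next
    case False
    with assms have \<sigma>: "0 < sqrt v" by simp
    let ?d = "normal_density m (sqrt v)"
    \<comment> \<open>The integrand equals \<open>?d x * x\<^sup>2\<close>; the split into central
      second moment, first moment and mass leaves only terms of known integrability.\<close>
    have "integrable lborel
      (\<lambda>x. ?d x * (x - m)^2 + 2 * m * (?d x * x) - m\<^sup>2 * ?d x)"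
      using integrable_normal_moment[OF \<sigma>] integrable_normal_moment_nz_1[OF \<sigma>] \<sigma>
        integrable_normal_density[OF \<sigma>]
      by (intro Bochner_Integration.integrable_diff Bochner_Integration.integrable_add
          integrable_mult_right)
    then have "integrable lborel (\<lambda>x. ?d x * x\<^sup>2)"
      by (simp add: power2_eq_square algebra_simps)
    with False show ?thesis
      by (simp add: normal_law_def integrable_density)
  qed
  show "(LINT x|normal_law m v. (x - m)\<^sup>2) = v"
  proof (cases "v = 0")
    case False
    with assms have \<sigma>: "0 < sqrt v" by simp
    show ?thesis
      \<comment> \<open>The index \<open>1\<close> stands for the central moment of order
        \<open>2 * 1\<close>, whose value is the square of \<open>sqrt v\<close>.\<close>
      using integral_normal_moment_even[OF \<sigma>, of m 1] False assms
      by (simp add: normal_law_def integral_density eval_nat_numeral)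
  qed (simp add: normal_law_def integral_return)
qed

section \<open>Bilinearity of the covariance\<close>

text \<open>A class on which \<open>covariance\<close> is additive. A non-integrable function has
  Bochner integral 0, so additivity can fail outside it.\<close>

definition square_integrable :: "'w measure \<Rightarrow> ('w \<Rightarrow> real) \<Rightarrow> bool" where
  "square_integrable M X \<longleftrightarrow> X \<in> borel_measurable M \<and> integrable M (\<lambda>\<omega>. (X \<omega>)\<^sup>2)"

lemma integrable_mult_square_integrable:
  assumes "square_integrable M X" "square_integrable M Y"
  shows "integrable M (\<lambda>\<omega>. X \<omega> * Y \<omega>)"
proof (rule Bochner_Integration.integrable_bound)
  show "integrable M (\<lambda>\<omega>. (X \<omega>)\<^sup>2 + (Y \<omega>)\<^sup>2)"
    using assms by (simp add: square_integrable_def)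
  show "(\<lambda>\<omega>. X \<omega> * Y \<omega>) \<in> borel_measurable M"
    using assms by (auto simp: square_integrable_def)
  have "\<bar>x * y\<bar> \<le> x\<^sup>2 + y\<^sup>2" for x y :: real
  proof -
    have "2 * (\<bar>x\<bar> * \<bar>y\<bar>) \<le> x\<^sup>2 + y\<^sup>2"
      using sum_squares_bound[of "\<bar>x\<bar>" "\<bar>y\<bar>"] by (simp add: mult.assoc)
    moreover have "0 \<le> \<bar>x\<bar> * \<bar>y\<bar>" by simp
    ultimately show ?thesis unfolding abs_mult by linarith
  qed
  then show "AE \<omega> in M. norm (X \<omega> * Y \<omega>) \<le> norm ((X \<omega>)\<^sup>2 + (Y \<omega>)\<^sup>2)"
    by simp
qed

lemma square_integrable_add:
  assumes "square_integrable M X" "square_integrable M Y"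
  shows "square_integrable M (\<lambda>\<omega>. X \<omega> + Y \<omega>)"
  using assms integrable_mult_square_integrable[OF assms]
  by (auto simp: square_integrable_def power2_sum mult.assoc)

lemma square_integrable_mult_left:
  assumes "square_integrable M X"
  shows "square_integrable M (\<lambda>\<omega>. k * X \<omega>)"
  using assms by (auto simp: square_integrable_def power_mult_distrib)

lemma covariance_commute: "covariance M X Y = covariance M Y X"
  by (simp add: covariance_def mult.commute)

lemma covariance_mult_left: "covariance M (\<lambda>\<omega>. k * X \<omega>) Y = k * covariance M X Y"
  by (simp add: covariance_def mult.assoc flip: right_diff_distrib)

context prob_space
begin

lemma integrable_of_square_integrable:
  assumes "square_integrable M X"
  shows "integrable M X"
  using assms square_integrable_imp_integrable by (auto simp: square_integrable_def)

lemma covariance_eq: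
  assumes "square_integrable M X" "square_integrable M Y"
  shows "covariance M X Y = expectation (\<lambda>\<omega>. X \<omega> * Y \<omega>) - expectation X * expectation Y"
  using integrable_mult_square_integrable[OF assms] assms[THEN integrable_of_square_integrable]
  by (simp add: covariance_def algebra_simps prob_space)

lemma covariance_add_left:
  assumes "square_integrable M X" "square_integrable M Y" "square_integrable M Z"
  shows "covariance M (\<lambda>\<omega>. X \<omega> + Y \<omega>) Z = covariance M X Z + covariance M Y Z"
  using assms
  by (simp add: covariance_eq square_integrable_add distrib_right
      integrable_mult_square_integrable integrable_of_square_integrable)

lemma covariance_add_right:
  assumes "square_integrable M X" "square_integrable M Y" "square_integrable M Z"
  shows "covariance M Z (\<lambda>\<omega>. X \<omega> + Y \<omega>) = covariance M Z X + covariance M Z Y"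
  using covariance_add_left[OF assms] by (simp add: covariance_commute[of M Z])

lemma covariance_sum_left:
  assumes "finite I" "\<And>j. j \<in> I \<Longrightarrow> square_integrable M (X j)" "square_integrable M Z"
  shows "square_integrable M (\<lambda>\<omega>. \<Sum>j\<in>I. X j \<omega>) \<and>
         covariance M (\<lambda>\<omega>. \<Sum>j\<in>I. X j \<omega>) Z = (\<Sum>j\<in>I. covariance M (X j) Z)"
  using assms(1,2)
proof (induction rule: finite_induct)
  case empty
  show ?case by (simp add: covariance_def square_integrable_def)
next
  case (insert j I)
  then show ?case
    using assms(3) by (simp add: square_integrable_add covariance_add_left)
qed

lemma
  fixes P :: "'a \<Rightarrow> real ^ 'm"
  assumes P: "\<And>j. square_integrable M (\<lambda>\<omega>. P \<omega> $ j)" and "square_integrable M Z"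
  shows square_integrable_inner: "square_integrable M (\<lambda>\<omega>. x \<bullet> P \<omega>)"
    and covariance_inner_left:
      "covariance M (\<lambda>\<omega>. x \<bullet> P \<omega>) Z = x \<bullet> (\<chi> j. covariance M Z (\<lambda>\<omega>. P \<omega> $ j))"
proof -
  note * = covariance_sum_left[of UNIV "\<lambda>j \<omega>. x $ j * P \<omega> $ j" Z]
  show "square_integrable M (\<lambda>\<omega>. x \<bullet> P \<omega>)"
    using * assms by (simp add: inner_vec_def square_integrable_mult_left)
  show "covariance M (\<lambda>\<omega>. x \<bullet> P \<omega>) Z = x \<bullet> (\<chi> j. covariance M Z (\<lambda>\<omega>. P \<omega> $ j))"
    using * assms
    by (simp add: inner_vec_def square_integrable_mult_left covariance_mult_left
        covariance_commute[of M Z])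
qed

text \<open>Expresses the bilinear form of the covariance matrix through scalar variables; its
  symmetry and positive semidefiniteness are later read off from this.\<close>

lemma covariance_inner_inner:
  fixes P :: "'a \<Rightarrow> real ^ 'm"
  assumes P: "\<And>j. square_integrable M (\<lambda>\<omega>. P \<omega> $ j)"
  shows "covariance M (\<lambda>\<omega>. x \<bullet> P \<omega>) (\<lambda>\<omega>. y \<bullet> P \<omega>) = x \<bullet> (covariance_matrix M P *v y)"
proof -
  have "covariance M (\<lambda>\<omega>. y \<bullet> P \<omega>) (\<lambda>\<omega>. P \<omega> $ j) = (covariance_matrix M P *v y) $ j" for j
    using covariance_inner_left[OF P P, of y j]
    by (simp add: covariance_matrix_def matrix_vector_mult_def inner_vec_def mult.commute)
  then show ?thesis
    using covariance_inner_left[OF P square_integrable_inner[OF P P]]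
    by (simp add: vec_lambda_unique)
qed

text \<open>Follows by expansion in the standard basis. Integrability of the whole vector lets the
  expectation pass through \<open>x \<bullet> P \<omega>\<close>.\<close>

lemma integrable_vec:
  fixes P :: "'a \<Rightarrow> real ^ 'm"
  assumes "\<And>j. integrable M (\<lambda>\<omega>. P \<omega> $ j)"
  shows "integrable M P"
proof -
  have "integrable M (\<lambda>\<omega>. \<Sum>j\<in>UNIV. P \<omega> $ j *\<^sub>R axis j (1::real))"
    using assms by (intro Bochner_Integration.integrable_sum integrable_scaleR_left)
  moreover have "(\<Sum>j\<in>UNIV. x $ j *\<^sub>R axis j 1) = x" for x :: "real ^ 'm"
    using basis_expansion[of x] by (simp add: scalar_mult_eq_scaleR)
  ultimately show ?thesis by simp
qed

section \<open>Normal random variables and their entropic risk\<close>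

text \<open>Change of variables along \<open>distr\<close>. Identifying \<open>m\<close> and
  \<open>v\<close> with the expectation and variance of \<open>X\<close> removes them from the
  conclusions, which suits \<open>gaussian_vector\<close>, where they are only existentially
  quantified.\<close>

lemma normal_law_rv:
  assumes X[measurable]: "X \<in> borel_measurable M" and "0 \<le> v" and D: "distr M borel X = normal_law m v"
  shows square_integrable_normal: "square_integrable M X"
    and exp_normal: "integrable M (\<lambda>\<omega>. exp (t * X \<omega>))"
       "expectation (\<lambda>\<omega>. exp (t * X \<omega>)) = exp (t * expectation X + t\<^sup>2 * covariance M X X / 2)"
proof -
  note I = integrable_distr_eq[OF X] integral_distr[OF X]
  have m: "expectation X = m"
    using integral_normal_law_ident[OF \<open>0 \<le> v\<close>, of m] unfolding D[symmetric] by (simp add: I)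
  have v: "covariance M X X = v"
    using integral_normal_law_square[OF \<open>0 \<le> v\<close>, of m] unfolding D[symmetric]
    by (simp add: I covariance_def m power2_eq_square)
  show "square_integrable M X"
    using integrable_normal_law_square[OF \<open>0 \<le> v\<close>, of m] unfolding D[symmetric]
    by (simp add: I square_integrable_def)
  show "integrable M (\<lambda>\<omega>. exp (t * X \<omega>))"
    using integrable_normal_law_exp[OF \<open>0 \<le> v\<close>, of m t] unfolding D[symmetric]
    by (simp add: I)
  show "expectation (\<lambda>\<omega>. exp (t * X \<omega>)) = exp (t * expectation X + t\<^sup>2 * covariance M X X / 2)"
    using integral_normal_law_exp[OF \<open>0 \<le> v\<close>, of m t] unfolding D[symmetric]
    by (simp add: I m v)
qed

end

text \<open>Exponential moments of both signs suffice, because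
  \<open>exp \<bar>y\<bar> \<le> exp y + exp (- y)\<close>.\<close>

lemma exp_moment_spaceI:
  assumes [measurable]: "L \<in> borel_measurable M" and "\<And>t. integrable M (\<lambda>\<omega>. exp (t * L \<omega>))"
  shows "L \<in> exp_moment_space M"
proof -
  have "integrable M (\<lambda>\<omega>. exp (c * \<bar>L \<omega>\<bar>))" for c
  proof (rule Bochner_Integration.integrable_bound)
    show "integrable M (\<lambda>\<omega>. exp (c * L \<omega>) + exp (- c * L \<omega>))"
      using assms(2) by (rule Bochner_Integration.integrable_add) (rule assms(2))
    show "AE \<omega> in M. norm (exp (c * \<bar>L \<omega>\<bar>)) \<le> norm (exp (c * L \<omega>) + exp (- c * L \<omega>))"
    proof (rule AE_I2)
      fix \<omega>
      have "exp \<bar>c * L \<omega>\<bar> \<le> exp (c * L \<omega>) + exp (- c * L \<omega>)"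
        by (simp add: abs_if)
      moreover have "exp (c * \<bar>L \<omega>\<bar>) \<le> exp \<bar>c * L \<omega>\<bar>"
        by (simp add: abs_mult mult_right_mono)
      ultimately show "norm (exp (c * \<bar>L \<omega>\<bar>)) \<le> norm (exp (c * L \<omega>) + exp (- c * L \<omega>))"
        unfolding real_norm_def abs_exp_cancel by linarith
    qed
  qed simp
  then show ?thesis by (simp add: exp_moment_space_def)
qed

text \<open>Membership in the domain has to be shown, since the risk is \<open>undefined\<close>
  outside it. The value then comes from the moment generating function of \<open>X\<close> at
  \<open>- r\<close>, whose logarithm is quadratic in \<open>r\<close>.\<close>

lemma (in prob_space) entropic_risk_normal:
  assumes X[measurable]: "X \<in> borel_measurable M" and "0 \<le> v" and D: "distr M borel X = normal_law m v"
    and "0 < r"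
  shows "entropic_risk M r (\<lambda>\<omega>. a - X \<omega>) = a - expectation X + r / 2 * covariance M X X"
proof -
  have e: "exp (t * (a - X \<omega>)) = exp (t * a) * exp (- t * X \<omega>)" for t \<omega>
    by (simp add: algebra_simps flip: exp_add)
  have "(\<lambda>\<omega>. a - X \<omega>) \<in> exp_moment_space M"
    by (rule exp_moment_spaceI) (simp_all only: e integrable_mult_right exp_normal(1)[OF assms(1-3)], measurable)
  moreover have "expectation (\<lambda>\<omega>. exp (r * (a - X \<omega>))) =
      exp (r * a) * exp (- r * expectation X + r\<^sup>2 * covariance M X X / 2)"
    unfolding e using exp_normal(2)[OF assms(1-3), of "- r"] by simp
  then have "ln (expectation (\<lambda>\<omega>. exp (r * (a - X \<omega>)))) =
      r * a - r * expectation X + r\<^sup>2 * covariance M X X / 2"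
    by (simp flip: exp_add)
  ultimately show ?thesis
    using \<open>0 < r\<close> by (simp add: entropic_risk_def power2_eq_square field_simps)
qed

section \<open>Gaussian vectors and the risk of a portfolio\<close>

text \<open>The index type splits into \<open>None\<close> and the range of \<open>Some\<close>.
  This makes the combinations \<open>a * R \<omega> + x \<bullet> P \<omega>\<close> projections of
  the joint vector.\<close>

lemma inner_cons_vec: "cons_vec a x \<bullet> cons_vec b y = a * b + x \<bullet> y"
  by (simp add: inner_vec_def cons_vec_def UNIV_option_conv sum.reindex)

lemma gaussian_cons_vec_linear:
  assumes "gaussian_vector M (\<lambda>\<omega>. cons_vec (R \<omega>) (P \<omega>))"
  shows "(\<lambda>\<omega>. a * R \<omega> + x \<bullet> P \<omega>) \<in> borel_measurable M"
    and "\<exists>m v. 0 \<le> v \<and> distr M borel (\<lambda>\<omega>. a * R \<omega> + x \<bullet> P \<omega>) = normal_law m v"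
proof -
  let ?X = "\<lambda>\<omega>. cons_vec a x \<bullet> cons_vec (R \<omega>) (P \<omega>)"
  have "?X \<in> borel_measurable M" "\<exists>m v. 0 \<le> v \<and> distr M borel ?X = normal_law m v"
    using assms unfolding gaussian_vector_def by auto
  then show "(\<lambda>\<omega>. a * R \<omega> + x \<bullet> P \<omega>) \<in> borel_measurable M"
    "\<exists>m v. 0 \<le> v \<and> distr M borel (\<lambda>\<omega>. a * R \<omega> + x \<bullet> P \<omega>) = normal_law m v"
    by (simp_all add: inner_cons_vec)
qed

context prob_space
begin

lemma gaussian_cons_vec_square_integrable:
  assumes "gaussian_vector M (\<lambda>\<omega>. cons_vec (R \<omega>) (P \<omega>))"
  shows "square_integrable M R" "square_integrable M (\<lambda>\<omega>. P \<omega> $ j)"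
proof -
  have *: "square_integrable M (\<lambda>\<omega>. a * R \<omega> + x \<bullet> P \<omega>)" for a x
    using gaussian_cons_vec_linear[OF assms] square_integrable_normal by blast
  show "square_integrable M R" using *[of 1 0] by simp
  show "square_integrable M (\<lambda>\<omega>. P \<omega> $ j)" using *[of 0 "axis j 1"] by (simp add: inner_axis')
qed

text \<open>The loss is the constant \<open>x \<bullet> p\<close> minus
  \<open>R \<omega> + x \<bullet> P \<omega>\<close>, a projection of the Gaussian vector and hence
  normal. Expanding its variance yields the constant, linear and quadratic parts in
  \<open>x\<close>.\<close>

lemma entropic_risk_portfolio:
  assumes G: "gaussian_vector M (\<lambda>\<omega>. cons_vec (R \<omega>) (P \<omega>))" and "0 < r"
  shows "entropic_risk M r (\<lambda>\<omega>. - R \<omega> + x \<bullet> (p - P \<omega>)) =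
    (r / 2 * covariance M R R - expectation R) +
    x \<bullet> (p - (LINT \<omega>|M. P \<omega>) + r *\<^sub>R (\<chi> j. covariance M R (\<lambda>\<omega>. P \<omega> $ j))) +
    r / 2 * (x \<bullet> (covariance_matrix M P *v x))"
proof -
  let ?X = "\<lambda>\<omega>. R \<omega> + x \<bullet> P \<omega>"
  note R = gaussian_cons_vec_square_integrable(1)[OF G]
    and P = gaussian_cons_vec_square_integrable(2)[OF G]
  note xP = square_integrable_inner[OF P R]
  have iP: "integrable M P"
    using P by (intro integrable_vec integrable_of_square_integrable)
  have E: "expectation ?X = expectation R + x \<bullet> (LINT \<omega>|M. P \<omega>)"
    using R iP by (simp add: integrable_of_square_integrable)
  have "covariance M ?X ?X =
      covariance M R R + 2 * covariance M (\<lambda>\<omega>. x \<bullet> P \<omega>) R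
      + covariance M (\<lambda>\<omega>. x \<bullet> P \<omega>) (\<lambda>\<omega>. x \<bullet> P \<omega>)"
    by (simp add: covariance_add_left[OF R xP] covariance_add_right[OF R xP]
        square_integrable_add R xP covariance_commute[of M R "\<lambda>\<omega>. x \<bullet> P \<omega>"])
  then have V: "covariance M ?X ?X =
      covariance M R R + 2 * (x \<bullet> (\<chi> j. covariance M R (\<lambda>\<omega>. P \<omega> $ j)))
      + x \<bullet> (covariance_matrix M P *v x)"
    by (simp add: covariance_inner_left[OF P R] covariance_inner_inner[OF P])
  obtain m v where "0 \<le> v" "distr M borel ?X = normal_law m v" "?X \<in> borel_measurable M"
    using gaussian_cons_vec_linear[OF G, of 1 x] by auto
  then have "entropic_risk M r (\<lambda>\<omega>. x \<bullet> p - ?X \<omega>) =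
      x \<bullet> p - expectation ?X + r / 2 * covariance M ?X ?X"
    using \<open>0 < r\<close> by (intro entropic_risk_normal)
  also have "(\<lambda>\<omega>. x \<bullet> p - ?X \<omega>) = (\<lambda>\<omega>. - R \<omega> + x \<bullet> (p - P \<omega>))"
    by (simp add: inner_diff_right algebra_simps)
  finally show ?thesis
    unfolding E V inner_add_right inner_diff_right inner_scaleR_right by (simp add: field_simps)
qed

lemma covariance_matrix_symmetric:
  fixes P :: "'a \<Rightarrow> real ^ 'm"
  assumes "\<And>j. square_integrable M (\<lambda>\<omega>. P \<omega> $ j)"
  shows "x \<bullet> (covariance_matrix M P *v y) = y \<bullet> (covariance_matrix M P *v x)"
  using covariance_inner_inner[OF assms] covariance_commute by metis

lemma covariance_matrix_nonneg:
  fixes P :: "'a \<Rightarrow> real ^ 'm"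
  assumes "\<And>j. square_integrable M (\<lambda>\<omega>. P \<omega> $ j)"
  shows "0 \<le> x \<bullet> (covariance_matrix M P *v x)"
  unfolding covariance_inner_inner[OF assms, symmetric] covariance_def by simp

end

section \<open>Minimisers of a convex quadratic function\<close>

text \<open>The right-hand side says that the gradient at \<open>x\<close> vanishes. By convexity a
  stationary point is a global minimiser; at any other point a short step against the gradient
  lowers the value.\<close>

lemma quadratic_minimizer_iff:
  fixes A :: "real ^ 'n ^ 'n"
  assumes sym: "\<And>x y. x \<bullet> (A *v y) = y \<bullet> (A *v x)" and nonneg: "\<And>x. 0 \<le> x \<bullet> (A *v x)"
    and "0 < r"
  shows "(\<forall>y. k + x \<bullet> b + r / 2 * (x \<bullet> (A *v x)) \<le> k + y \<bullet> b + r / 2 * (y \<bullet> (A *v y))) \<longleftrightarrow>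
         b + r *\<^sub>R (A *v x) = 0" (is "?min \<longleftrightarrow> ?g = 0")
proof -
  \<comment> \<open>Exact second-order Taylor expansion at \<open>x\<close>; symmetry of
    \<open>A\<close> merges the two mixed terms.\<close>
  have expand: "k + (x + d) \<bullet> b + r / 2 * ((x + d) \<bullet> (A *v (x + d))) =
      (k + x \<bullet> b + r / 2 * (x \<bullet> (A *v x))) + (d \<bullet> ?g + r / 2 * (d \<bullet> (A *v d)))" for d
    using sym[of x d]
    by (simp add: matrix_vector_right_distrib inner_add_left inner_add_right algebra_simps)
  have translate: "(\<forall>y. Q y) \<longleftrightarrow> (\<forall>d. Q (x + d))" for Q
  proof
    assume *: "\<forall>d. Q (x + d)"
    have "Q y" for y
      using spec[OF *, of "y - x"] by simp
    then show "\<forall>y. Q y" ..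
  qed simp
  have "?min \<longleftrightarrow> (\<forall>d. 0 \<le> d \<bullet> ?g + r / 2 * (d \<bullet> (A *v d)))"
    by (subst translate, unfold expand) simp
  also have "\<dots> \<longleftrightarrow> ?g = 0"
  proof
    assume *: "\<forall>d. 0 \<le> d \<bullet> ?g + r / 2 * (d \<bullet> (A *v d))"
    show "?g = 0"
    proof (rule ccontr)
      assume "?g \<noteq> 0"
      then have s: "0 < ?g \<bullet> ?g" by simp
      define a where "a = r / 2 * (?g \<bullet> (A *v ?g))"
      have "0 \<le> a" using nonneg \<open>0 < r\<close> by (simp add: a_def)
      \<comment> \<open>Moving by \<open>- t\<close> times the gradient changes the value by
        \<open>t * (t * a - ?g \<bullet> ?g)\<close>, so a positive \<open>t\<close> with
        \<open>t * a < ?g \<bullet> ?g\<close> is wanted. Dividing by \<open>1 + a\<close> rather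
        than \<open>a\<close> covers \<open>a = 0\<close>.\<close>
      define t where "t = ?g \<bullet> ?g / (1 + a)"
      have t: "0 < t" "t * a < ?g \<bullet> ?g"
        using \<open>0 \<le> a\<close> s by (simp_all add: t_def divide_less_eq distrib_left del: inner_gt_zero_iff)
      have "((- t) *\<^sub>R ?g) \<bullet> ?g + r / 2 * (((- t) *\<^sub>R ?g) \<bullet> (A *v ((- t) *\<^sub>R ?g))) =
          t * (t * a - ?g \<bullet> ?g)"
        unfolding matrix_vector_mult_scaleR inner_scaleR_left inner_scaleR_right a_def
        by (simp only: algebra_simps)
      then have "0 \<le> t * (t * a - ?g \<bullet> ?g)"
        using spec[OF *, of "(- t) *\<^sub>R ?g"] by simp
      moreover have "t * (t * a - ?g \<bullet> ?g) < 0"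
        using t by (intro mult_pos_neg) auto
      ultimately show False by simp
    qed
  next
    assume "?g = 0"
    then show "\<forall>d. 0 \<le> d \<bullet> ?g + r / 2 * (d \<bullet> (A *v d))"
      using nonneg \<open>0 < r\<close> by simp
  qed
  finally show ?thesis .
qed

section \<open>Existence and uniqueness of the equilibrium\<close>

theorem proposition2p4:
  fixes M :: "'w measure"
    and E :: "'i set"
    and R :: "'i \<Rightarrow> 'w \<Rightarrow> real"
    and P :: "'w \<Rightarrow> real ^ 'm"
    and \<mu>\<^sub>E :: "'i \<Rightarrow> real ^ ('m option)"
    and \<Gamma>\<^sub>E :: "'i \<Rightarrow> real ^ ('m option) ^ ('m option)"
    and \<Gamma> :: "real ^ 'm ^ 'm"
    and r :: "'i \<Rightarrow> real"
    and \<mu> :: "real ^ 'm"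
    and c :: "'i \<Rightarrow> real ^ 'm"
    and cov :: "real ^ 'm"
    and r\<^sub>E :: real
    and q :: "'i \<Rightarrow> real ^ 'm"
    and p :: "real ^ 'm"
  assumes "prob_space M"
    and "finite E" and "E \<noteq> {}"
    and "\<And>i. i \<in> E \<Longrightarrow> multivariate_normal M (\<lambda>\<omega>. cons_vec (R i \<omega>) (P \<omega>)) (\<mu>\<^sub>E i) (\<Gamma>\<^sub>E i)"
    and "\<Gamma> = covariance_matrix M P" and "invertible \<Gamma>"
    and "\<And>i. i \<in> E \<Longrightarrow> r i > 0"
    and "\<mu> = (LINT \<omega>|M. P \<omega>)"
    and "\<And>i. i \<in> E \<Longrightarrow> c i = (\<chi> j. covariance M (R i) (\<lambda>\<omega>. P \<omega> $ j))"
    and "cov = (\<Sum>i\<in>E. c i)"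
    and "r\<^sub>E = inverse (\<Sum>i\<in>E. 1 / r i)"
    and "\<And>i. i \<in> E \<Longrightarrow> q i = matrix_inv \<Gamma> *v ((r\<^sub>E / r i) *\<^sub>R cov - c i)"
    and "p = \<mu> - r\<^sub>E *\<^sub>R cov"
  shows "radner_equilibrium E (\<lambda>i. entropic_risk M (r i)) R P q p \<and>
         (\<forall>q' p'. radner_equilibrium E (\<lambda>i. entropic_risk M (r i)) R P q' p' \<longrightarrow>
            (\<forall>i\<in>E. q' i = q i) \<and> p' = p)"
proof -
  interpret prob_space M by fact
  have G: "gaussian_vector M (\<lambda>\<omega>. cons_vec (R i \<omega>) (P \<omega>))" if "i \<in> E" for i
    using assms(4)[OF that] by (simp add: multivariate_normal_def)
  \<comment> \<open>Square integrability of \<open>P\<close> is drawn from its joint law with some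
    \<open>R i\<close>, so one agent is picked.\<close>
  obtain i0 where "i0 \<in> E" using \<open>E \<noteq> {}\<close> by blast
  note P = gaussian_cons_vec_square_integrable(2)[OF G[OF \<open>i0 \<in> E\<close>]]
  \<comment> \<open>\<open>matrix_inv\<close> is a Hilbert choice; invertibility ensures that the
    chosen matrix is a two-sided inverse.\<close>
  have inv: "\<Gamma> ** matrix_inv \<Gamma> = mat 1" "matrix_inv \<Gamma> ** \<Gamma> = mat 1"
    using someI_ex[OF \<open>invertible \<Gamma>\<close>[unfolded invertible_def]] by (simp_all add: matrix_inv_def)
  have solve: "\<Gamma> *v x = y \<longleftrightarrow> x = matrix_inv \<Gamma> *v y" for x y
    using inv by (metis matrix_vector_mul_assoc matrix_vector_mul_lid)
  \<comment> \<open>The quadratic criterion with linear coefficient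
    \<open>p' - \<mu> + r i *\<^sub>R c i\<close>, solved for \<open>\<Gamma> *v x\<close> after
    division by \<open>r i\<close>.\<close>
  have optimal: "(\<forall>y. entropic_risk M (r i) (\<lambda>\<omega>. - R i \<omega> + x \<bullet> (p' - P \<omega>)) \<le>
        entropic_risk M (r i) (\<lambda>\<omega>. - R i \<omega> + y \<bullet> (p' - P \<omega>))) \<longleftrightarrow>
      \<Gamma> *v x = (1 / r i) *\<^sub>R (\<mu> - p') - c i" if i: "i \<in> E" for i x p'
  proof -
    have "0 < r i" using assms(7) i by simp
    have "\<Gamma> *v x = (1 / r i) *\<^sub>R (\<mu> - p') - c i \<longleftrightarrow>
        r i *\<^sub>R (\<Gamma> *v x) = r i *\<^sub>R ((1 / r i) *\<^sub>R (\<mu> - p') - c i)"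
      using \<open>0 < r i\<close> by simp
    also have "\<dots> \<longleftrightarrow> p' - \<mu> + r i *\<^sub>R c i + r i *\<^sub>R (\<Gamma> *v x) = 0"
      using \<open>0 < r i\<close> by (auto simp: scaleR_diff_right algebra_simps)
    finally show ?thesis
      unfolding entropic_risk_portfolio[OF G[OF i] \<open>0 < r i\<close>] \<open>\<Gamma> = covariance_matrix M P\<close>
        \<open>\<mu> = (LINT \<omega>|M. P \<omega>)\<close> assms(9)[OF i]
        quadratic_minimizer_iff[OF covariance_matrix_symmetric[OF P] covariance_matrix_nonneg[OF P]
          \<open>0 < r i\<close>]
      by simp
  qed
  have "0 < (\<Sum>i\<in>E. 1 / r i)"
    using assms(2,3,7) by (intro sum_pos) auto
  then have "r\<^sub>E \<noteq> 0" and rE: "(\<Sum>i\<in>E. 1 / r i) = 1 / r\<^sub>E"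
    by (simp_all add: \<open>r\<^sub>E = inverse (\<Sum>i\<in>E. 1 / r i)\<close> inverse_eq_divide)
  \<comment> \<open>Summing the first-order conditions shows that \<open>\<Gamma>\<close> maps total
    demand to \<open>(1 / r\<^sub>E) *\<^sub>R (p - p')\<close>.\<close>
  have clearing: "(\<Sum>i\<in>E. x i) = 0 \<longleftrightarrow> p' = p"
    if x: "\<And>i. i \<in> E \<Longrightarrow> \<Gamma> *v x i = (1 / r i) *\<^sub>R (\<mu> - p') - c i" for x p'
  proof -
    have "\<Gamma> *v (\<Sum>i\<in>E. x i) = (\<Sum>i\<in>E. \<Gamma> *v x i)"
      by (induction E rule: infinite_finite_induct) (simp_all add: matrix_vector_right_distrib)
    also have "\<dots> = (1 / r\<^sub>E) *\<^sub>R (\<mu> - p') - cov"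
      by (simp add: x sum_subtractf \<open>cov = (\<Sum>i\<in>E. c i)\<close> flip: rE scaleR_sum_left)
    also have "\<dots> = (1 / r\<^sub>E) *\<^sub>R (p - p')"
      using \<open>r\<^sub>E \<noteq> 0\<close> by (simp add: \<open>p = \<mu> - r\<^sub>E *\<^sub>R cov\<close> algebra_simps)
    \<comment> \<open>The first form gives clearing from \<open>p' = p\<close>, the second gives the
      converse.\<close>
    finally have "(\<Sum>i\<in>E. x i) = matrix_inv \<Gamma> *v ((1 / r\<^sub>E) *\<^sub>R (p - p'))"
      "\<Gamma> *v (\<Sum>i\<in>E. x i) = (1 / r\<^sub>E) *\<^sub>R (p - p')"
      by (simp_all flip: solve)
    then show ?thesis
      using \<open>r\<^sub>E \<noteq> 0\<close> by auto
  qed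
  \<comment> \<open>Here \<open>\<mu> - p\<close> is \<open>r\<^sub>E *\<^sub>R cov\<close>, so the
    explicit portfolio is the solution of the first-order condition at \<open>p\<close>.\<close>
  have q: "x = q i \<longleftrightarrow> \<Gamma> *v x = (1 / r i) *\<^sub>R (\<mu> - p) - c i" if "i \<in> E" for i x
    unfolding solve by (simp add: assms(12)[OF that] \<open>p = \<mu> - r\<^sub>E *\<^sub>R cov\<close>)
  \<comment> \<open>One equivalence settles both claims: read at \<open>q\<close> and
    \<open>p\<close> it gives existence, from left to right it gives uniqueness.\<close>
  have "radner_equilibrium E (\<lambda>i. entropic_risk M (r i)) R P q' p' \<longleftrightarrow>
      (\<forall>i\<in>E. q' i = q i) \<and> p' = p" for q' p'
  proof -
    have "radner_equilibrium E (\<lambda>i. entropic_risk M (r i)) R P q' p' \<longleftrightarrow>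
        (\<forall>i\<in>E. \<Gamma> *v q' i = (1 / r i) *\<^sub>R (\<mu> - p') - c i) \<and> (\<Sum>i\<in>E. q' i) = 0"
      by (simp only: radner_equilibrium_def optimal cong: ball_cong)
    \<comment> \<open>Clearing fixes the price first; only at \<open>p' = p\<close> do the
      first-order conditions single out the portfolios \<open>q i\<close>.\<close>
    also have "\<dots> \<longleftrightarrow> (\<forall>i\<in>E. \<Gamma> *v q' i = (1 / r i) *\<^sub>R (\<mu> - p') - c i) \<and> p' = p"
      using clearing[of q' p'] by blast
    also have "\<dots> \<longleftrightarrow> (\<forall>i\<in>E. q' i = q i) \<and> p' = p"
      using q by blast
    finally show ?thesis .
  qed
  then show ?thesis by simp
qed

end
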